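(* $$\lim_{n\to\infty} n^{2}\left(\left(\frac{(n+1)^{n+1}}{n^{n}}-\frac{n^{n}}{(n-1)^{n-1}}\right)-e\right)=\frac{e}{24}.$$
   Context: Here $n$ ranges over the integers $n\ge 2$ and $e$ is the base of the natural logarithm. *)

theory Defs
  imports Complex_Main
begin

end

theory Submission
  imports Defs "HOL-Real_Asymp.Real_Asymp"
begin

text \<open>
  With \<open>x = 1/n\<close>, the quotient \<open>(n+1)^(n+1) / n^n\<close> equals
  \<open>(n + 1) * exp (ln (1 + x) / x)\<close>, and likewise
  \<open>n^n / (n-1)^(n-1) = (n - 1) * exp (- ln (1 - x) / x)\<close>: the second term is the first
  one with \<open>x\<close> replaced by \<open>-x\<close>, up to sign. Hence the difference is twice the part
  that is even in \<open>x\<close> of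
  \<open>(1 + 1/x) * exp (ln (1 + x) / x)\<close>, where
  \<open>exp (ln (1 + x) / x) = e * (1 - x/2 + 11 x^2/24 - 7 x^3/16 + O(x^4))\<close>.
  Its constant term is \<open>2 e (1 - 1/2) = e\<close> and its coefficient at \<open>x^2\<close> is
  \<open>2 e (11/24 - 7/16) = e/24\<close>, which is the limit. So the theorem needs the exponential
  form of the two quotients (\<open>Suc_power_quotient_exp\<close>) and an expansion to this order.
\<close>

text \<open>The exponential form makes sense for a real argument in place of \<open>m\<close>, and it avoids a
  power with variable base and exponent. Both quotients of the theorem are instances, with
  \<open>m = n\<close> and \<open>m = n - 1\<close>.\<close>
lemma Suc_power_quotient_exp:
  fixes m :: nat
  assumes "m > 0"
  shows "(real m + 1) ^ (m + 1) / real m ^ m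
           = (real m + 1) * exp (real m * (ln (real m + 1) - ln (real m)))"
proof -
  have "exp (real m * (ln (real m + 1) - ln (real m))) = ((real m + 1) / real m) ^ m"
    using assms by (simp add: exp_of_nat_mult exp_diff)
  then show ?thesis
    by (simp add: power_divide)
qed

text \<open>The Taylor expansion above, carried out for a real variable tending to infinity.\<close>
lemma quotient_difference_asymptotics:
  "((\<lambda>x::real. x\<^sup>2 * (((x + 1) * exp (x * (ln (x + 1) - ln x))
        - x * exp ((x - 1) * (ln x - ln (x - 1)))) - exp 1)) \<longlongrightarrow> exp 1 / 24) at_top"
  by real_asymp

theorem mainTheorem2:
  shows "(\<lambda>n::nat. (real n)^2 *
            (((real n + 1) ^ (n + 1) / (real n) ^ n
              - (real n) ^ n / (real n - 1) ^ (n - 1)) - exp 1))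
         \<longlonglongrightarrow> exp 1 / 24"
proof (rule Lim_transform_eventually)
  show "(\<lambda>n::nat. (real n)\<^sup>2 * (((real n + 1) * exp (real n * (ln (real n + 1) - ln (real n)))
          - real n * exp ((real n - 1) * (ln (real n) - ln (real n - 1)))) - exp 1))
        \<longlonglongrightarrow> exp 1 / 24"
    by (rule filterlim_compose[OF quotient_difference_asymptotics filterlim_real_sequentially])
  show "\<forall>\<^sub>F n in sequentially.
          (real n)\<^sup>2 * (((real n + 1) * exp (real n * (ln (real n + 1) - ln (real n)))
            - real n * exp ((real n - 1) * (ln (real n) - ln (real n - 1)))) - exp 1)
          = (real n)^2 * (((real n + 1) ^ (n + 1) / (real n) ^ n
              - (real n) ^ n / (real n - 1) ^ (n - 1)) - exp 1)"
    using eventually_ge_at_top[of 2]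
  proof eventually_elim
    case (elim n)
    then show ?case
      using Suc_power_quotient_exp[of n] Suc_power_quotient_exp[of "n - 1"]
      by (simp add: of_nat_diff)
  qed
qed

end
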